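(* Let $Q$ and $T$ be bounded subsets of $\mathbb{R}^{3}$, each having nonempty interior. Then $Q\sim_{G_3}T$, i.e. $Q$ and $T$ are $G_3$-equidecomposable.
   Context: $G_3$ denotes the group of isometries of $\mathbb{R}^3$ (Euclidean norm), acting on $\mathbb{R}^3$ in the obvious way. Two sets $A,B\subseteq\mathbb{R}^3$ are $G_3$-equidecomposable, written $A\sim_{G_3}B$, if there are finite decompositions into pairwise disjoint sets $A=\bigcup_{i=1}^{n}A_i$ and $B=\bigcup_{i=1}^{n}B_i$ (with the same $n$) and elements $g_1,\dots,g_n\in G_3$ with $g_i(A_i)=B_i$ for every $i=1,\dots,n$. *)

theory Defs
  imports "HOL-Analysis.Analysis"
begin

(* bij is part of the definition so that this is visibly a group; on Euclidean spaces
   surjectivity would already follow from preservation of distances. *)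
definition isometry_group :: "('a::metric_space \<Rightarrow> 'a) set" where
  "isometry_group = {g. bij g \<and> (\<forall>x y. dist (g x) (g y) = dist x y)}"

lemma id_in_isometry_group: "id \<in> isometry_group"
  by (simp add: isometry_group_def)

lemma comp_in_isometry_group:
  "g \<in> isometry_group \<Longrightarrow> h \<in> isometry_group \<Longrightarrow> g \<circ> h \<in> isometry_group"
  by (simp add: isometry_group_def bij_comp)

lemma inv_in_isometry_group:
  assumes "g \<in> isometry_group" shows "inv g \<in> isometry_group"
proof -
  have g: "bij g" "\<And>x y. dist (g x) (g y) = dist x y"
    using assms by (auto simp: isometry_group_def)
  have "dist (inv g x) (inv g y) = dist x y" for x y
    using g(2)[of "inv g x" "inv g y"] g(1) by (simp add: bij_is_surj surj_f_inv_f)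
  with g(1) show ?thesis by (simp add: isometry_group_def bij_imp_bij_inv)
qed

abbreviation G3 :: "(real^3 \<Rightarrow> real^3) set" where
  "G3 \<equiv> isometry_group"

(* G is a set of transformations of 'a acting by application. The pieces are arbitrary,
   possibly empty, sets. *)
definition equidecomposable :: "('a \<Rightarrow> 'a) set \<Rightarrow> 'a set \<Rightarrow> 'a set \<Rightarrow> bool" where
  "equidecomposable G A B \<longleftrightarrow>
    (\<exists>(n::nat) (P :: nat \<Rightarrow> 'a set) (R :: nat \<Rightarrow> 'a set) (g :: nat \<Rightarrow> 'a \<Rightarrow> 'a).
       A = (\<Union>i\<in>{1..n}. P i) \<and> disjoint_family_on P {1..n} \<and>
       B = (\<Union>i\<in>{1..n}. R i) \<and> disjoint_family_on R {1..n} \<and>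
       (\<forall>i\<in>{1..n}. g i \<in> G \<and> g i ` P i = R i))"

end

theory Submission
  imports Defs
begin

text \<open>
  Equidecomposability of \<open>A\<close> and \<open>B\<close> means that there is a bijection from \<open>A\<close> to \<open>B\<close> which at
  every point agrees with one of finitely many isometries; the pieces are then the sets on
  which a given isometry is the one in use.  In this form equidecomposition is a matter of
  composing, restricting and gluing maps, and the Schroeder-Bernstein construction applies
  (\<open>equidecomposable_if_piecewise_embeds\<close>).  So it suffices to inject an arbitrary bounded
  set piecewise isometrically into an arbitrary set with interior points, and then to
  exchange the roles of the two sets.

  For this injection, take a small open ball \<open>B\<close> around \<open>0\<close>, a translate of which fits into the
  target.  Two rotations about perpendicular axes, both with cosine \<open>3/5\<close>, generate a free
  group.  Remove from \<open>B\<close> the points fixed by some nontrivial element of the group; on the rest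
  \<open>X\<close> the group acts freely, and the Hausdorff paradox puts two disjoint piecewise isometric
  copies of \<open>X\<close> into \<open>X\<close> (\<open>paradoxical_ball_off_axes\<close>).  Iterating gives any finite number of
  disjoint copies inside \<open>X\<close> (\<open>paradoxical_copies\<close>).  If finitely many translates of \<open>X\<close> cover
  the bounded set, sending each translate to a copy of its own embeds the bounded set into
  \<open>X\<close>.

  The removed points form a countable union of lines through \<open>0\<close>.  Translation
  regains them: for a vector \<open>v\<close> that is not a difference
  of two removed points, a point removed from one translate of the ball is present in the
  translate moved by \<open>v\<close>.  Such \<open>v\<close> exist arbitrarily close to \<open>0\<close>, since the differences lie in
  countably many planes (\<open>finitely_many_translates_cover\<close>).
\<close>

section \<open>Piecewise isometries\<close>

definition piecewise_isometry :: "('a::metric_space \<Rightarrow> 'a) \<Rightarrow> 'a set \<Rightarrow> bool" where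
  "piecewise_isometry f A \<longleftrightarrow>
    (\<exists>H. finite H \<and> H \<subseteq> isometry_group \<and> (\<forall>x\<in>A. \<exists>h\<in>H. f x = h x))"

lemma piecewise_isometryI:
  "finite H \<Longrightarrow> H \<subseteq> isometry_group \<Longrightarrow> (\<And>x. x \<in> A \<Longrightarrow> \<exists>h\<in>H. f x = h x) \<Longrightarrow>
   piecewise_isometry f A"
  unfolding piecewise_isometry_def by blast

lemma piecewise_isometryE:
  assumes "piecewise_isometry f A"
  obtains H where "finite H" "H \<subseteq> isometry_group" "\<And>x. x \<in> A \<Longrightarrow> \<exists>h\<in>H. f x = h x"
  using assms unfolding piecewise_isometry_def by blast

lemma piecewise_isometry_isometry: "g \<in> isometry_group \<Longrightarrow> piecewise_isometry g A"
  by (rule piecewise_isometryI[of "{g}"]) auto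

lemma piecewise_isometry_subset:
  "piecewise_isometry f B \<Longrightarrow> A \<subseteq> B \<Longrightarrow> piecewise_isometry f A"
  unfolding piecewise_isometry_def by blast

lemma piecewise_isometry_comp:
  assumes "piecewise_isometry f A" "piecewise_isometry g B" "f ` A \<subseteq> B"
  shows "piecewise_isometry (\<lambda>x. g (f x)) A"
proof -
  obtain H where H: "finite H" "H \<subseteq> isometry_group" "\<And>x. x \<in> A \<Longrightarrow> \<exists>h\<in>H. f x = h x"
    using assms(1) by (rule piecewise_isometryE) blast
  obtain K where K: "finite K" "K \<subseteq> isometry_group" "\<And>x. x \<in> B \<Longrightarrow> \<exists>h\<in>K. g x = h x"
    using assms(2) by (rule piecewise_isometryE) blast
  show ?thesis
  proof (rule piecewise_isometryI)
    show "finite ((\<lambda>(k, h). k \<circ> h) ` Sigma K (\<lambda>_. H))"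
      using H(1) K(1) by auto
    show "(\<lambda>(k, h). k \<circ> h) ` Sigma K (\<lambda>_. H) \<subseteq> isometry_group"
      using H(2) K(2) by (auto intro!: comp_in_isometry_group)
    fix x assume x: "x \<in> A"
    then obtain h where h: "h \<in> H" "f x = h x" using H(3) by blast
    moreover have "f x \<in> B" using x assms(3) by blast
    then obtain k where "k \<in> K" "g (f x) = k (f x)" using K(3) by blast
    ultimately show "\<exists>u\<in>(\<lambda>(k, h). k \<circ> h) ` Sigma K (\<lambda>_. H). g (f x) = u x"
      by (intro bexI[of _ "k \<circ> h"]) auto
  qed
qed

lemma piecewise_isometry_glue:
  assumes "finite C" and "\<And>x. x \<in> A \<Longrightarrow> c x \<in> C"
    and "\<And>i. i \<in> C \<Longrightarrow> piecewise_isometry (f i) {x \<in> A. c x = i}"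
  shows "piecewise_isometry (\<lambda>x. f (c x) x) A"
proof -
  have "\<forall>i\<in>C. \<exists>H. finite H \<and> H \<subseteq> isometry_group \<and> (\<forall>x\<in>{x \<in> A. c x = i}. \<exists>h\<in>H. f i x = h x)"
    using assms(3) unfolding piecewise_isometry_def by blast
  then obtain H where H: "\<And>i. i \<in> C \<Longrightarrow> finite (H i) \<and> H i \<subseteq> isometry_group \<and>
      (\<forall>x\<in>{x \<in> A. c x = i}. \<exists>h\<in>H i. f i x = h x)"
    by metis
  show ?thesis
  proof (rule piecewise_isometryI)
    show "finite (\<Union>i\<in>C. H i)" using H assms(1) by blast
    show "(\<Union>i\<in>C. H i) \<subseteq> isometry_group" using H by blast
    show "\<exists>h\<in>(\<Union>i\<in>C. H i). f (c x) x = h x" if "x \<in> A" for x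
      using H[OF assms(2)[OF that]] that assms(2)[OF that] by blast
  qed
qed

lemma piecewise_isometry_if:
  assumes "piecewise_isometry f {x \<in> A. P x}" "piecewise_isometry g {x \<in> A. \<not> P x}"
  shows "piecewise_isometry (\<lambda>x. if P x then f x else g x) A"
proof -
  have "piecewise_isometry (\<lambda>x. (\<lambda>b. if b then f else g) (P x) x) A"
    by (rule piecewise_isometry_glue[of UNIV]) (use assms in \<open>auto split: if_splits\<close>)
  moreover have "(\<lambda>x. (\<lambda>b. if b then f else g) (P x) x) = (\<lambda>x. if P x then f x else g x)"
    by auto
  ultimately show ?thesis by simp
qed

text \<open>
  Closure of the isometries under inverses enters here; this is what the inverted half of the
  Schroeder-Bernstein bijection needs.
\<close>

lemma piecewise_isometry_inv_into:
  assumes "piecewise_isometry f A" "inj_on f A"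
  shows "piecewise_isometry (inv_into A f) (f ` A)"
proof -
  obtain H where H: "finite H" "H \<subseteq> isometry_group" "\<And>x. x \<in> A \<Longrightarrow> \<exists>h\<in>H. f x = h x"
    using assms(1) by (rule piecewise_isometryE) blast
  show ?thesis
  proof (rule piecewise_isometryI)
    show "finite (inv ` H)" using H by blast
    show "inv ` H \<subseteq> isometry_group" using H by (auto intro: inv_in_isometry_group)
    fix y assume "y \<in> f ` A"
    then obtain x where x: "x \<in> A" "y = f x" by blast
    then obtain h where h: "h \<in> H" "f x = h x" using H by blast
    then have "inv h y = x"
      using H(2) x by (auto simp: isometry_group_def bij_is_inj)
    moreover have "inv_into A f y = x"
      using x assms(2) by simp
    ultimately show "\<exists>u\<in>inv ` H. inv_into A f y = u y"
      using h by (intro bexI[of _ "inv h"]) auto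
  qed
qed

text \<open>
  Several of the finitely many isometries may serve at the same point, so the pieces are made
  disjoint by always using the first one in a fixed enumeration.
\<close>

lemma equidecomposable_if_piecewise_isometry:
  fixes f :: "'a::metric_space \<Rightarrow> 'a"
  assumes pw: "piecewise_isometry f A" and bij: "bij_betw f A B"
  shows "equidecomposable isometry_group A B"
proof -
  obtain H where H: "finite H" "H \<subseteq> isometry_group" "\<And>x. x \<in> A \<Longrightarrow> \<exists>h\<in>H. f x = h x"
    using pw by (rule piecewise_isometryE) blast
  obtain g where g: "bij_betw g {1..card H} H"
    using ex_bij_betw_nat_finite_1[OF H(1)] by blast
  define i where "i x = (LEAST j. j \<in> {1..card H} \<and> f x = g j x)" for x
  have i: "i x \<in> {1..card H} \<and> f x = g (i x) x" if x: "x \<in> A" for x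
  proof -
    obtain h where "h \<in> H" "f x = h x" using H(3)[OF x] by blast
    then obtain j where "j \<in> {1..card H} \<and> f x = g j x"
      using g unfolding bij_betw_def by (metis imageE)
    then show ?thesis unfolding i_def by (rule LeastI)
  qed
  define P where "P j = {x \<in> A. i x = j}" for j
  have inj: "inj_on f A" and img: "f ` A = B"
    using bij by (auto simp: bij_betw_def)
  have "A = (\<Union>j\<in>{1..card H}. P j)"
    using i by (auto simp: P_def)
  moreover have "B = (\<Union>j\<in>{1..card H}. f ` P j)"
  proof -
    have "f ` A = (\<Union>j\<in>{1..card H}. f ` P j)"
      by (subst \<open>A = _\<close>) (simp only: image_UN)
    then show ?thesis using img by simp
  qed
  moreover have "disjoint_family_on P {1..card H}"
    by (auto simp: disjoint_family_on_def P_def)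
  moreover have "disjoint_family_on (\<lambda>j. f ` P j) {1..card H}"
    unfolding disjoint_family_on_def P_def using inj by (auto dest: inj_onD)
  moreover have "\<forall>j\<in>{1..card H}. g j \<in> isometry_group \<and> g j ` P j = f ` P j"
  proof
    fix j assume j: "j \<in> {1..card H}"
    have "g j \<in> isometry_group" using j g H(2) by (auto simp: bij_betw_def)
    moreover have "g j ` P j = f ` P j"
      by (rule image_cong) (use i in \<open>auto simp: P_def\<close>)
    ultimately show "g j \<in> isometry_group \<and> g j ` P j = f ` P j" ..
  qed
  ultimately show ?thesis
    unfolding equidecomposable_def by blast
qed

definition piecewise_embeds :: "'a::metric_space set \<Rightarrow> 'a set \<Rightarrow> bool" where
  "piecewise_embeds A B \<longleftrightarrow> (\<exists>f. piecewise_isometry f A \<and> inj_on f A \<and> f ` A \<subseteq> B)"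

theorem equidecomposable_if_piecewise_embeds:
  fixes A B :: "'a::metric_space set"
  assumes "piecewise_embeds A B" and "piecewise_embeds B A"
  shows "equidecomposable isometry_group A B"
proof -
  obtain f where f: "piecewise_isometry f A" "inj_on f A" "f ` A \<subseteq> B"
    using assms(1) unfolding piecewise_embeds_def by blast
  obtain g where g: "piecewise_isometry g B" "inj_on g B" "g ` B \<subseteq> A"
    using assms(2) unfolding piecewise_embeds_def by blast
  \<comment> \<open>The Schroeder-Bernstein bijection is \<open>f\<close> on \<open>S\<close> and the inverse of \<open>g\<close> off \<open>S\<close>.\<close>
  define S where "S = lfp (\<lambda>X. A - g ` (B - f ` X))"
  have "mono (\<lambda>X. A - g ` (B - f ` X))"
    by (intro monoI) blast
  then have S: "S = A - g ` (B - f ` S)"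
    unfolding S_def by (rule lfp_unfold)
  define h where "h x = (if x \<in> S then f x else inv_into B g x)" for x
  have SA: "S \<subseteq> A" using S by blast
  have rest: "A - S = g ` (B - f ` S)"
    using S g(3) by blast
  have inv: "inv_into B g ` (A - S) = B - f ` S"
    unfolding rest using g(2) by (auto simp: image_image)
  have "piecewise_isometry h A"
    unfolding h_def
  proof (rule piecewise_isometry_if)
    show "piecewise_isometry f {x \<in> A. x \<in> S}"
      using f(1) by (rule piecewise_isometry_subset) auto
    show "piecewise_isometry (inv_into B g) {x \<in> A. x \<notin> S}"
      using piecewise_isometry_inv_into[OF g(1,2)]
      by (rule piecewise_isometry_subset) (use rest in auto)
  qed
  moreover have "bij_betw h A B"
  proof -
    have "bij_betw h S (f ` S)"
      using inj_on_subset[OF f(2) SA] by (auto simp: bij_betw_def h_def inj_on_def)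
    moreover have "bij_betw (inv_into B g) (A - S) (B - f ` S)"
      unfolding bij_betw_def inv
      by (rule conjI[OF inj_on_subset[OF inj_on_inv_into[of "g ` B"]]]) (use rest in auto)
    then have "bij_betw h (A - S) (B - f ` S)"
      by (rule bij_betw_cong[THEN iffD1, rotated]) (simp add: h_def)
    ultimately have "bij_betw h (S \<union> (A - S)) (f ` S \<union> (B - f ` S))"
      by (rule bij_betw_combine) blast
    moreover have "S \<union> (A - S) = A" "f ` S \<union> (B - f ` S) = B"
      using SA f(3) by auto
    ultimately show ?thesis by simp
  qed
  ultimately show ?thesis
    by (rule equidecomposable_if_piecewise_isometry)
qed

section \<open>Two independent rotations\<close>

definition orientation :: "bool \<times> bool \<Rightarrow> int" where
  "orientation l = (if snd l then 1 else -1)"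

text \<open>
  The rotations by \<open>arccos (3/5)\<close> about the third and the first coordinate axis, together with
  their inverses.  The first component of the index selects the axis, the second the
  direction.
\<close>

definition rot :: "bool \<times> bool \<Rightarrow> real^3 \<Rightarrow> real^3" where
  "rot l v = (let e = of_int (orientation l) in
     if fst l then vector [(3 * v$1 + 4 * e * v$2) / 5, (3 * v$2 - 4 * e * v$1) / 5, v$3]
     else vector [v$1, (3 * v$2 + 4 * e * v$3) / 5, (3 * v$3 - 4 * e * v$2) / 5])"

definition opp :: "bool \<times> bool \<Rightarrow> bool \<times> bool" where
  "opp l = (fst l, \<not> snd l)"

lemma opp_opp [simp]: "opp (opp l) = l" and opp_neq [simp]: "opp l \<noteq> l" "l \<noteq> opp l"
  by (auto simp: opp_def prod_eq_iff)

lemma rot_opp [simp]: "rot (opp l) (rot l v) = v"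
  by (auto simp: rot_def orientation_def opp_def Let_def vec_eq_iff forall_3 field_simps)

lemma rot_opp' [simp]: "rot l (rot (opp l) v) = v"
  using rot_opp[of "opp l" v] by simp

lemma linear_rot: "linear (rot l)"
  by (rule linearI) (auto simp: rot_def orientation_def Let_def vec_eq_iff forall_3 field_simps)

lemma inner_rot: "rot l v \<bullet> rot l w = v \<bullet> w"
  by (auto simp: rot_def orientation_def Let_def inner_vec_def sum_3 field_simps)

lemma cross_rot: "cross3 (rot l v) (rot l w) = rot l (cross3 v w)"
  by (auto simp: rot_def orientation_def Let_def cross3_def vec_eq_iff forall_3 field_simps)

text \<open>
  Modulo \<open>5\<close>, the integer matrix of \<open>5\<close> times a rotation \<open>rot l\<close> has rank one.  With \<open>e\<close> the
  orientation of \<open>l\<close>, its image is spanned by \<open>(1, 2e, 0)\<close> or \<open>(0, 1, 2e)\<close>, according to the axis.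
  The following triples are those congruent to a nonzero multiple of this vector.  The kernel
  of the matrix meets the image belonging to an index \<open>m\<close> nontrivially only if \<open>m\<close> is opposite to
  \<open>l\<close>, so in a product of these matrices without cancellation every factor sends the image of
  its predecessor onto its own image, and the product does not vanish modulo \<open>5\<close>.
\<close>

definition residue_class :: "bool \<times> bool \<Rightarrow> int \<Rightarrow> int \<Rightarrow> int \<Rightarrow> bool" where
  "residue_class l x y z \<longleftrightarrow> (let e = orientation l in
     if fst l then \<not> 5 dvd x \<and> 5 dvd y - 2 * e * x \<and> 5 dvd z
     else 5 dvd x \<and> \<not> 5 dvd y \<and> 5 dvd z - 2 * e * y)"

text \<open>
  The ping-pong regions.  A rational vector is assigned to a region after its denominator, a
  power of \<open>5\<close>, has been cleared.  The exponent is positive, so integer vectors belong to no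
  region; a product of at least one rotation can thereby be told from the identity.
\<close>

definition pong :: "bool \<times> bool \<Rightarrow> (real^3) set" where
  "pong l = {v. \<exists>k x y z. residue_class l x y z \<and>
     5 ^ Suc k *\<^sub>R v = vector [of_int x, of_int y, of_int z]}"

lemma residue_class_nonzero:
  "residue_class l x y z \<Longrightarrow> \<not> (5 dvd x \<and> 5 dvd y \<and> 5 dvd z)"
  by (auto simp: residue_class_def Let_def split: if_splits)

lemma residue_class_unique:
  assumes "residue_class l x y z" "residue_class l' x y z"
  shows "l = l'"
proof -
  have "fst l = fst l'"
    using assms unfolding residue_class_def Let_def by argo
  moreover have "snd l = snd l'"
  proof (rule ccontr)
    assume "snd l \<noteq> snd l'"
    then have s: "orientation l' = - orientation l" "orientation l = 1 \<or> orientation l = -1"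
      by (auto simp: orientation_def)
    have both: "5 dvd a" if "5 dvd b - 2 * orientation l * a" "5 dvd b - 2 * - orientation l * a"
      for a b
    proof -
      have "5 dvd 4 * (orientation l * a)"
        using dvd_diff[OF that(2,1)] by (simp add: mult.commute)
      moreover have "5 dvd u" if "5 dvd 4 * u" for u :: int using that by presburger
      ultimately have "5 dvd orientation l * a" by blast
      with s(2) show ?thesis by (elim disjE) simp_all
    qed
    show False
      using assms both[of y x] both[of z y] unfolding residue_class_def Let_def s(1) by argo
  qed
  ultimately show ?thesis by (simp add: prod_eq_iff)
qed

text \<open>
  The power of \<open>5\<close> clearing the denominator is determined by the vector: passing to a higher
  power would make all coordinates divisible by \<open>5\<close>, but a residue class consists of triples
  that do not vanish modulo \<open>5\<close>.
\<close>

lemma pong_unique: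
  assumes "v \<in> pong l" "v \<in> pong l'"
  shows "l = l'"
proof -
  have *: "k = k' \<and> x = x' \<and> y = y' \<and> z = z'"
    if r: "residue_class m' x' y' z'" and le: "k \<le> k'"
      and e: "5 ^ Suc k *\<^sub>R v = vector [of_int x, of_int y, of_int z]"
      and e': "5 ^ Suc k' *\<^sub>R v = vector [of_int x', of_int y', of_int z']"
    for m' k k' x y z x' y' z'
  proof -
    obtain d where d: "k' = k + d" using le le_Suc_ex by blast
    have "5 ^ Suc k' *\<^sub>R v = 5 ^ d *\<^sub>R (5 ^ Suc k *\<^sub>R v)"
      by (simp add: d power_add)
    then have "vector [of_int x', of_int y', of_int z'] =
        (5 ^ d *\<^sub>R vector [of_int x, of_int y, of_int z] :: real^3)"
      by (simp only: e e')
    then have "real_of_int x' = of_int (5 ^ d * x)" "real_of_int y' = of_int (5 ^ d * y)"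
        "real_of_int z' = of_int (5 ^ d * z)"
      by (auto simp: vec_eq_iff forall_3)
    then have xyz: "x' = 5 ^ d * x" "y' = 5 ^ d * y" "z' = 5 ^ d * z"
      by (simp_all only: of_int_eq_iff)
    have "d = 0"
    proof (rule ccontr)
      assume "d \<noteq> 0"
      then have "(5::int) dvd 5 ^ d" by simp
      then show False using residue_class_nonzero[OF r] xyz by auto
    qed
    then show ?thesis using d xyz by simp
  qed
  obtain k x y z where v: "residue_class l x y z"
      "5 ^ Suc k *\<^sub>R v = vector [of_int x, of_int y, of_int z]"
    using assms(1) unfolding pong_def by blast
  obtain k' x' y' z' where v': "residue_class l' x' y' z'"
      "5 ^ Suc k' *\<^sub>R v = vector [of_int x', of_int y', of_int z']"
    using assms(2) unfolding pong_def by blast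
  have "x = x' \<and> y = y' \<and> z = z'"
    using *[OF v'(1) _ v(2) v'(2)] *[OF v(1) _ v'(2) v(2)] nat_le_linear[of k k'] by blast
  then show ?thesis using residue_class_unique v(1) v'(1) by blast
qed

text \<open>
  In the plane of a rotation, \<open>5\<close> times the rotation maps \<open>(p, q)\<close> to \<open>(3p + 4eq, 3q - 4ep)\<close>.  The
  image satisfies the congruence of its residue class for every \<open>(p, q)\<close>; what depends on
  \<open>(p, q)\<close> is that it does not vanish modulo \<open>5\<close>.  The next three lemmas treat this for a vector
  coming from the same rotation, for a vector coming from the first coordinate axis and turned
  about the third one, and for the converse.
\<close>

lemma turn_residue:
  fixes p q e :: int
  assumes "e = 1 \<or> e = -1"
  shows "5 dvd (3 * q - 4 * e * p) - 2 * e * (3 * p + 4 * e * q)"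
proof -
  have "(3 * q - 4 * e * p) - 2 * e * (3 * p + 4 * e * q) = 5 * (- q - 2 * e * p)"
    using assms by auto
  then show ?thesis by (simp only: dvd_triv_left)
qed

lemma turn_same_axis:
  fixes p q e :: int
  assumes e: "e = 1 \<or> e = -1" and "5 dvd q - 2 * e * p"
  shows "5 dvd 3 * p + 4 * e * q \<longleftrightarrow> 5 dvd p"
proof -
  obtain j where "q - 2 * e * p = 5 * j" using assms(2) by blast
  then have q: "q = 2 * e * p + 5 * j" by simp
  have "3 * p + 4 * e * q = 11 * p + 5 * (4 * e * j)"
    unfolding q using e by auto
  moreover have "5 dvd 11 * p + 5 * k \<longleftrightarrow> 5 dvd p" for k by presburger
  ultimately show ?thesis by (simp only:)
qed

lemma turn_other_axis:
  fixes p q e :: int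
  assumes e: "e = 1 \<or> e = -1" and "5 dvd p"
  shows "5 dvd 3 * p + 4 * e * q \<longleftrightarrow> 5 dvd q"
proof -
  have "5 dvd 3 * p + 4 * e * q \<longleftrightarrow> 5 dvd 4 * e * q"
    using assms(2) by (simp add: dvd_add_right_iff)
  also have "\<dots> \<longleftrightarrow> 5 dvd q" using e by (elim disjE) (simp_all, presburger+)
  finally show ?thesis .
qed

lemma turn_crossed_axis:
  fixes p q s e f :: int
  assumes f: "f = 1 \<or> f = -1" and "5 dvd q" and "5 dvd p - 2 * f * s"
  shows "5 dvd 3 * p + 4 * e * q \<longleftrightarrow> 5 dvd s"
proof -
  obtain i where q: "q = 5 * i" using assms(2) by blast
  obtain j where "p - 2 * f * s = 5 * j" using assms(3) by blast
  then have p: "p = 2 * f * s + 5 * j" by simp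
  have "3 * p + 4 * e * q = f * (6 * s) + 5 * (3 * j + 4 * e * i)"
    unfolding p q by (simp add: algebra_simps)
  moreover have "5 dvd f * (6 * s) + 5 * k \<longleftrightarrow> 5 dvd s" for k
    using f by (elim disjE) (simp_all, presburger+)
  ultimately show ?thesis by (simp only:)
qed

lemma rot_pong:
  assumes "v \<in> pong l" "l \<noteq> opp m"
  shows "rot m v \<in> pong m"
proof -
  obtain k x y z where v: "residue_class l x y z"
      "5 ^ Suc k *\<^sub>R v = vector [of_int x, of_int y, of_int z]"
    using assms(1) unfolding pong_def by blast
  define e :: int where "e = orientation m"
  define x' y' z' where "x' = (if fst m then 3 * x + 4 * e * y else 5 * x)"
    and "y' = (if fst m then 3 * y - 4 * e * x else 3 * y + 4 * e * z)"
    and "z' = (if fst m then 5 * z else 3 * z - 4 * e * y)"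
  have "5 ^ Suc (Suc k) *\<^sub>R rot m v = 5 *\<^sub>R rot m (5 ^ Suc k *\<^sub>R v)"
    by (simp add: linear_cmul[OF linear_rot])
  also have "\<dots> = vector [of_int x', of_int y', of_int z']"
    unfolding v(2) by (auto simp: rot_def orientation_def x'_def y'_def z'_def e_def Let_def vec_eq_iff forall_3)
  finally have "5 ^ Suc (Suc k) *\<^sub>R rot m v = vector [of_int x', of_int y', of_int z']" .
  moreover have "residue_class m x' y' z'"
  proof -
    have e: "e = 1 \<or> e = -1" by (simp add: e_def orientation_def)
    have l: "fst l = fst m \<Longrightarrow> orientation l = e"
      using assms(2) by (auto simp: e_def orientation_def opp_def prod_eq_iff)
    note unfold = residue_class_def Let_def x'_def y'_def z'_def e_def[symmetric]
    show ?thesis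
    proof (cases "fst m")
      case True
      have "\<not> 5 dvd 3 * x + 4 * e * y"
      proof (cases "fst l")
        case same: True
        then have "\<not> 5 dvd x" "5 dvd y - 2 * e * x"
          using v(1) True l unfolding residue_class_def Let_def by simp_all
        then show ?thesis using turn_same_axis[OF e] by blast
      next
        case False
        then have "5 dvd x" "\<not> 5 dvd y"
          using v(1) unfolding residue_class_def Let_def by simp_all
        then show ?thesis using turn_other_axis[OF e] by blast
      qed
      then show ?thesis
        using turn_residue[OF e, of y x] True unfolding unfold by simp
    next
      case False
      have "\<not> 5 dvd 3 * y + 4 * e * z"
      proof (cases "fst l")
        case True
        then have "\<not> 5 dvd x" "5 dvd y - 2 * orientation l * x" "5 dvd z"
          using v(1) unfolding residue_class_def Let_def by simp_all
        moreover have "orientation l = 1 \<or> orientation l = -1" by (simp add: orientation_def)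
        ultimately show ?thesis using turn_crossed_axis[of "orientation l" z y x e] by blast
      next
        case same: False
        then have "\<not> 5 dvd y" "5 dvd z - 2 * e * y"
          using v(1) False l unfolding residue_class_def Let_def by simp_all
        then show ?thesis using turn_same_axis[OF e] by blast
      qed
      then show ?thesis
        using turn_residue[OF e, of z y] False unfolding unfold by simp
    qed
  qed
  ultimately show ?thesis unfolding pong_def by blast
qed

text \<open>
  The second basis vector lies in the kernel modulo \<open>5\<close> of none of the four matrices, so it can
  start the game for every first factor.
\<close>

lemma rot_base_pong: "rot m (vector [0, 1, 0]) \<in> pong m"
proof -
  define e :: int where "e = orientation m"
  have "5 ^ Suc 0 *\<^sub>R rot m (vector [0, 1, 0]) =
     vector [of_int (if fst m then 4 * e else 0), of_int 3, of_int (if fst m then 0 else -4 * e)]"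
    by (auto simp: rot_def orientation_def e_def Let_def vec_eq_iff forall_3)
  moreover have "residue_class m (if fst m then 4 * e else 0) 3 (if fst m then 0 else -4 * e)"
    by (auto simp: residue_class_def e_def orientation_def Let_def)
  ultimately show ?thesis unfolding pong_def by blast
qed

lemma base_notin_pong: "vector [0, 1, 0] \<notin> pong m"
proof
  assume "vector [0, 1, 0] \<in> pong m"
  then obtain k x y z where v: "residue_class m x y z"
      "5 ^ Suc k *\<^sub>R (vector [0, 1, 0] :: real^3) = vector [of_int x, of_int y, of_int z]"
    unfolding pong_def by blast
  from v(2) have "real_of_int x = of_int 0" "real_of_int y = of_int (5 * 5 ^ k)"
      "real_of_int z = of_int 0"
    by (auto simp: vec_eq_iff forall_3)
  then have "x = 0" "y = 5 * 5 ^ k" "z = 0"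
    by (simp_all only: of_int_eq_iff)
  then show False using residue_class_nonzero[OF v(1)] by simp
qed

section \<open>The free group they generate\<close>

definition act :: "(bool \<times> bool) list \<Rightarrow> real^3 \<Rightarrow> real^3" where
  "act w = foldr rot w"

definition rotations :: "(real^3 \<Rightarrow> real^3) set" where
  "rotations = range act"

lemma act_Nil: "act [] = id" and act_Cons: "act (l # w) = rot l \<circ> act w"
  and act_append: "act (u @ w) = act u \<circ> act w"
  by (auto simp: act_def fun_eq_iff)

lemma act_inverse: "act w (act (rev (map opp w)) v) = v"
  by (induction w arbitrary: v) (auto simp: act_Nil act_Cons act_append)

lemma act_inverse': "act (rev (map opp w)) (act w v) = v"
  by (induction w arbitrary: v) (auto simp: act_Nil act_Cons act_append)

lemma countable_rotations: "countable rotations"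
  unfolding rotations_def by simp

lemma id_rotations: "id \<in> rotations" unfolding rotations_def using act_Nil by (metis rangeI)

lemma comp_rotations: "g \<in> rotations \<Longrightarrow> h \<in> rotations \<Longrightarrow> g \<circ> h \<in> rotations"
  unfolding rotations_def by (auto simp flip: act_append)

lemma rot_rotations: "rot l \<in> rotations"
  unfolding rotations_def using act_Nil act_Cons[of l "[]"] by (metis comp_id rangeI)

lemma rotations_inverse:
  assumes "g \<in> rotations"
  obtains h where "h \<in> rotations" "h \<circ> g = id" "g \<circ> h = id"
proof -
  obtain w where "g = act w" using assms unfolding rotations_def by blast
  moreover have "act (rev (map opp w)) \<in> rotations" unfolding rotations_def by (rule rangeI)
  ultimately show ?thesis
    using that[of "act (rev (map opp w))"]
    by (simp add: fun_eq_iff act_inverse act_inverse')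
qed

lemma linear_rotations: "g \<in> rotations \<Longrightarrow> linear g"
proof -
  have "linear (act w)" for w
  proof (induction w)
    case Nil
    show ?case unfolding act_Nil by (rule linear_id)
  next
    case (Cons l w)
    then show ?case unfolding act_Cons using linear_rot by (rule linear_compose)
  qed
  then show "g \<in> rotations \<Longrightarrow> linear g" unfolding rotations_def by blast
qed

lemma inner_rotations: "g \<in> rotations \<Longrightarrow> g v \<bullet> g w = v \<bullet> w"
proof -
  have "act u v \<bullet> act u w = v \<bullet> w" for u
    by (induction u) (auto simp: act_Nil act_Cons inner_rot)
  then show "g \<in> rotations \<Longrightarrow> g v \<bullet> g w = v \<bullet> w" unfolding rotations_def by blast
qed

lemma norm_rotations: "g \<in> rotations \<Longrightarrow> norm (g v) = norm v"
  by (simp add: norm_eq_sqrt_inner inner_rotations)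

lemma cross_rotations: "g \<in> rotations \<Longrightarrow> cross3 (g v) (g w) = g (cross3 v w)"
proof -
  have "cross3 (act u v) (act u w) = act u (cross3 v w)" for u
    by (induction u) (auto simp: act_Nil act_Cons cross_rot)
  then show "g \<in> rotations \<Longrightarrow> cross3 (g v) (g w) = g (cross3 v w)" unfolding rotations_def by blast
qed

lemma rotations_isometry: "g \<in> rotations \<Longrightarrow> g \<in> isometry_group"
proof -
  assume g: "g \<in> rotations"
  obtain h where "h \<circ> g = id" "g \<circ> h = id" using rotations_inverse[OF g] by blast
  then have "bij g" using o_bij by blast
  moreover have "dist (g x) (g y) = dist x y" for x y
    using norm_rotations[OF g, of "x - y"] by (simp add: dist_norm linear_diff[OF linear_rotations[OF g]])
  ultimately show ?thesis by (simp add: isometry_group_def)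
qed

text \<open>
  The elements of the group that are given by a nonempty reduced word, with the leftmost letter
  of the word as an index.
\<close>

inductive begins_with :: "bool \<times> bool \<Rightarrow> (real^3 \<Rightarrow> real^3) \<Rightarrow> bool" where
  single: "begins_with l (rot l)"
| extend: "begins_with l g \<Longrightarrow> l \<noteq> opp m \<Longrightarrow> begins_with m (rot m \<circ> g)"

lemma begins_with_pong: "begins_with l g \<Longrightarrow> g (vector [0, 1, 0]) \<in> pong l"
  by (induction rule: begins_with.induct) (auto intro: rot_base_pong rot_pong)

text \<open>
  Freeness of the group, in the form in which it is used: the first letter can be read off from
  the region containing the image of the second basis vector.
\<close>

lemma begins_with_unique: "begins_with l g \<Longrightarrow> begins_with m g \<Longrightarrow> l = m"
  using begins_with_pong pong_unique by blast

lemma not_begins_with_id: "\<not> begins_with l id"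
  using begins_with_pong[of l id] base_notin_pong by auto

text \<open>
  A letter put in front of a reduced word either prolongs it or cancels its first letter.
\<close>

lemma rot_comp_cases:
  assumes "g = id \<or> (\<exists>l. begins_with l g)"
  shows "rot m \<circ> g = id \<or> (\<exists>l. begins_with l (rot m \<circ> g))"
proof (cases "begins_with (opp m) g")
  case True
  then show ?thesis
  proof cases
    case single
    then show ?thesis by (simp add: fun_eq_iff)
  next
    case (extend l h)
    then have "rot m \<circ> g = h" by (simp add: fun_eq_iff)
    then show ?thesis using extend by metis
  qed
next
  case False
  from assms have "\<exists>l. begins_with l (rot m \<circ> g)"
  proof (elim disjE exE)
    assume "g = id"
    then show ?thesis using begins_with.single[of m] by (simp only: comp_id) blast
  next
    fix l assume "begins_with l g"
    moreover from this have "l \<noteq> opp m" using False by blast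
    ultimately show ?thesis by (intro exI) (rule begins_with.extend)
  qed
  then show ?thesis ..
qed

lemma rotations_cases:
  assumes "g \<in> rotations"
  shows "g = id \<or> (\<exists>l. begins_with l g)"
proof -
  have "act w = id \<or> (\<exists>l. begins_with l (act w))" for w
  proof (induction w)
    case Nil
    show ?case by (simp add: act_Nil)
  next
    case (Cons l w)
    show ?case unfolding act_Cons using Cons by (rule rot_comp_cases)
  qed
  then show ?thesis using assms unfolding rotations_def by blast
qed

text \<open>
  The identity behind the paradox: the words beginning with \<open>l\<close>, together with the words
  beginning with its inverse translated by \<open>l\<close>, exhaust the group.
\<close>

lemma begins_with_opp:
  assumes "g \<in> rotations" "\<not> begins_with l g"
  shows "begins_with (opp l) (rot (opp l) \<circ> g)"
  using rotations_cases[OF assms(1)]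
proof
  assume "g = id"
  then show ?thesis using begins_with.single by simp
next
  assume "\<exists>m. begins_with m g"
  then obtain m where m: "begins_with m g" ..
  then have "m \<noteq> opp (opp l)" using assms(2) by auto
  with m show ?thesis by (rule begins_with.extend)
qed

section \<open>A paradoxical decomposition away from the axes\<close>

definition axes :: "(real^3) set" where
  "axes = {x. \<exists>g\<in>rotations. g \<noteq> id \<and> g x = x}"

text \<open>
  Orientation enters through the cross product, which the rotations preserve: if two independent
  vectors are fixed, then so is their cross product, hence a whole basis.
\<close>

lemma fixed_points_subset_line:
  assumes g: "g \<in> rotations" "g \<noteq> id"
  shows "\<exists>u. {x. g x = x} \<subseteq> span {u}"
proof (cases "{x. g x = x} \<subseteq> {0}")
  case True
  then show ?thesis by (intro exI[of _ 0]) auto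
next
  case False
  then obtain u where u: "g u = u" "u \<noteq> 0" by blast
  have "x \<in> span {u}" if x: "g x = x" for x
  proof (rule ccontr)
    assume nx: "x \<notin> span {u}"
    have ne: "cross3 u x \<noteq> 0"
    proof
      assume "cross3 u x = 0"
      then have "collinear {0, u, x}" by (simp add: cross_eq_0)
      then obtain c where "x = c *\<^sub>R u"
        using u(2) by (auto simp: collinear_lemma)
      then show False using nx by (simp add: span_base span_scale)
    qed
    have "g z = z" for z
    proof -
      \<comment> \<open>The displacement of any point is orthogonal to every fixed vector.\<close>
      have orth: "(g z - z) \<bullet> p = 0" if "g p = p" for p
        using inner_rotations[OF g(1), of z p] that by (simp add: inner_diff_left)
      have "(g z - z) \<bullet> u = 0" "(g z - z) \<bullet> x = 0" "(g z - z) \<bullet> cross3 u x = 0"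
        using u(1) x cross_rotations[OF g(1), of u x] by (auto intro!: orth)
      moreover from this have "cross3 (g z - z) (cross3 u x) = 0"
        by (simp add: Lagrange)
      ultimately show ?thesis
        using ne norm_and_cross_eq_0[of "g z - z" "cross3 u x"] by auto
    qed
    then have "g = id" by auto
    then show False using g(2) by blast
  qed
  then show ?thesis by blast
qed

lemma axes_differences_negligible: "negligible {p - q |p q. p \<in> axes \<and> q \<in> axes}"
proof -
  define u where "u g = (SOME u. {x. g x = x} \<subseteq> span {u})" for g :: "real^3 \<Rightarrow> real^3"
  have u: "{x. g x = x} \<subseteq> span {u g}" if "g \<in> rotations" "g \<noteq> id" for g
    unfolding u_def using fixed_points_subset_line[OF that] by (rule someI_ex)
  let ?S = "\<lambda>(g, h). span {u g, u h}"
  have "negligible (\<Union> (?S ` Sigma rotations (\<lambda>_. rotations)))"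
  proof (rule negligible_countable_Union)
    show "countable (?S ` Sigma rotations (\<lambda>_. rotations))"
      using countable_rotations by auto
    fix S assume "S \<in> ?S ` Sigma rotations (\<lambda>_. rotations)"
    then obtain g h where S: "S = span {u g, u h}" by auto
    have "dim S \<le> card {u g, u h}" unfolding S dim_span by (rule dim_le_card') simp
    also have "\<dots> < DIM(real^3)" by (simp add: card_insert_if)
    finally show "negligible S" by (rule negligible_lowdim)
  qed
  moreover have "{p - q |p q. p \<in> axes \<and> q \<in> axes} \<subseteq> \<Union> (?S ` Sigma rotations (\<lambda>_. rotations))"
  proof clarify
    fix p q assume "p \<in> axes" "q \<in> axes"
    then obtain g h where gh: "g \<in> rotations" "g \<noteq> id" "g p = p" "h \<in> rotations" "h \<noteq> id" "h q = q"
      unfolding axes_def by blast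
    then have "p \<in> span {u g}" "q \<in> span {u h}" using u by blast+
    then have "p \<in> span {u g, u h}" "q \<in> span {u g, u h}"
      using span_mono[of _ "{u g, u h}"] by blast+
    then have "p - q \<in> span {u g, u h}" by (rule span_diff)
    then show "p - q \<in> \<Union> (?S ` Sigma rotations (\<lambda>_. rotations))" using gh by auto
  qed
  ultimately show ?thesis by (rule negligible_subset)
qed

lemma rotations_preserves_axes:
  assumes g: "g \<in> rotations" and x: "x \<notin> axes"
  shows "g x \<notin> axes"
proof
  assume "g x \<in> axes"
  then obtain h where h: "h \<in> rotations" "h \<noteq> id" "h (g x) = g x" unfolding axes_def by blast
  obtain k where k: "k \<in> rotations" "k \<circ> g = id" "g \<circ> k = id" using rotations_inverse[OF g] by blast
  have kg: "k (g y) = y" "g (k y) = y" for y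
    using k by (auto simp: fun_eq_iff)
  have "(k \<circ> h \<circ> g) x = x" using h kg by simp
  moreover have "k \<circ> h \<circ> g \<in> rotations" using g h k by (simp add: comp_rotations)
  ultimately have "k \<circ> h \<circ> g = id" using x unfolding axes_def by blast
  then have "k (h (g y)) = y" for y by (simp add: fun_eq_iff)
  then have "h y = y" for y using kg by metis
  then show False using h(2) by auto
qed

lemma rotations_free_off_axes:
  assumes "g \<in> rotations" "h \<in> rotations" "x \<notin> axes" "g x = h x"
  shows "g = h"
proof -
  obtain k where k: "k \<in> rotations" "k \<circ> h = id" "h \<circ> k = id" using rotations_inverse[OF assms(2)] by blast
  then have "(k \<circ> g) x = x" using assms(4) by (simp add: fun_eq_iff)
  then have "k \<circ> g = id" using assms k comp_rotations unfolding axes_def by blast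
  then show ?thesis using k by (metis comp_assoc comp_id id_comp)
qed

text \<open>
  Here the axiom of choice is used: with one base point chosen in each orbit, a point off the
  axes is reached from its base point by exactly one group element, which is its coordinate.
\<close>

lemma orbit_coordinate:
  obtains c where "\<And>x. c x \<in> rotations"
    and "\<And>g x. g \<in> rotations \<Longrightarrow> x \<notin> axes \<Longrightarrow> c (g x) = g \<circ> c x"
proof -
  define orbit where "orbit x = {g x |g. g \<in> rotations}" for x
  define m where "m x = (SOME y. y \<in> orbit x)" for x
  have x_orbit: "x \<in> orbit x" for x
    unfolding orbit_def using id_rotations by (auto intro!: exI[of _ id])
  have orbit_eq: "orbit (g x) = orbit x" if g: "g \<in> rotations" for g x
  proof -
    obtain k where k: "k \<in> rotations" "k \<circ> g = id" using rotations_inverse[OF g] by blast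
    have "h (g x) \<in> orbit x" if "h \<in> rotations" for h
      unfolding orbit_def using comp_rotations[OF that g] by (auto intro!: exI[of _ "h \<circ> g"])
    moreover have "h x \<in> orbit (g x)" if "h \<in> rotations" for h
    proof -
      have "(h \<circ> k) (g x) = h x" using k by (simp add: fun_eq_iff)
      then show ?thesis
        unfolding orbit_def using comp_rotations[OF that k(1)] by (auto intro!: exI[of _ "h \<circ> k"])
    qed
    ultimately show ?thesis unfolding orbit_def by blast
  qed
  have m: "m x \<in> orbit x" for x
    unfolding m_def using x_orbit by (rule someI)
  have ex: "\<exists>g. g \<in> rotations \<and> g (m x) = x" for x
  proof -
    obtain g where g: "g \<in> rotations" "m x = g x" using m unfolding orbit_def by blast
    obtain k where "k \<in> rotations" "k \<circ> g = id" using rotations_inverse[OF g(1)] by blast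
    then show ?thesis using g by (metis comp_apply id_apply)
  qed
  define c where "c x = (SOME g. g \<in> rotations \<and> g (m x) = x)" for x
  have c: "c x \<in> rotations" "c x (m x) = x" for x
    using someI_ex[OF ex] unfolding c_def by blast+
  have "c (g x) = g \<circ> c x" if g: "g \<in> rotations" and x: "x \<notin> axes" for g x
  proof (rule rotations_free_off_axes)
    show "c (g x) \<in> rotations" "g \<circ> c x \<in> rotations" using c g comp_rotations by auto
    obtain h where "h \<in> rotations" "m x = h x" using m unfolding orbit_def by blast
    then show "m x \<notin> axes" using rotations_preserves_axes x by simp
    have "m (g x) = m x" unfolding m_def by (simp add: orbit_eq[OF g])
    then show "c (g x) (m x) = (g \<circ> c x) (m x)"
      using c(2)[of x] c(2)[of "g x"] by simp
  qed
  then show ?thesis using that c by blast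
qed

definition paradoxical :: "'a::metric_space set \<Rightarrow> bool" where
  "paradoxical X \<longleftrightarrow> (\<exists>f f'. piecewise_isometry f X \<and> piecewise_isometry f' X \<and>
     inj_on f X \<and> inj_on f' X \<and> f ` X \<subseteq> X \<and> f' ` X \<subseteq> X \<and> f ` X \<inter> f' ` X = {})"

text \<open>
  The coordinate transports the decomposition of the free group to the points off the axes.  For
  each of the two axes, one map compresses everything into the points whose coordinate begins
  with a rotation about that axis, in either direction; the two images are disjoint.
\<close>

theorem paradoxical_ball_off_axes: "paradoxical (ball 0 r - axes)"
proof -
  let ?X = "ball 0 r - axes"
  obtain c where cF: "\<And>x. c x \<in> rotations"
    and c: "\<And>g x. g \<in> rotations \<Longrightarrow> x \<notin> axes \<Longrightarrow> c (g x) = g \<circ> c x"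
    using orbit_coordinate by blast
  define f where "f l x = (if begins_with l (c x) then x else rot (opp l) x)" for l x
  have pw: "piecewise_isometry (f l) ?X" for l
    unfolding f_def
  proof (rule piecewise_isometry_if)
    show "piecewise_isometry (\<lambda>x. x) {x \<in> ?X. begins_with l (c x)}"
      using piecewise_isometry_isometry[OF id_in_isometry_group] by (simp add: id_def)
    show "piecewise_isometry (rot (opp l)) {x \<in> ?X. \<not> begins_with l (c x)}"
      by (intro piecewise_isometry_isometry rotations_isometry rot_rotations)
  qed
  have c_f: "begins_with (if begins_with l (c x) then l else opp l) (c (f l x))" if "x \<in> ?X" for l x
    using that begins_with_opp[OF cF] by (auto simp: f_def c[OF rot_rotations])
  have img: "f l ` ?X \<subseteq> ?X" for l
    using norm_rotations[OF rot_rotations, of "opp l"] rotations_preserves_axes[OF rot_rotations, of _ "opp l"]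
    by (auto simp: f_def)
  have inj: "inj_on (f l) ?X" for l
  proof (rule inj_onI)
    fix x y assume x: "x \<in> ?X" and y: "y \<in> ?X" and eq: "f l x = f l y"
    have same: "begins_with l (c x) \<longleftrightarrow> begins_with l (c y)"
      using c_f[OF x, of l] c_f[OF y, of l] eq begins_with_unique[of l _ "opp l"]
      by (auto split: if_splits)
    show "x = y"
    proof (cases "begins_with l (c x)")
      case True
      then show ?thesis using same eq by (simp add: f_def)
    next
      case False
      then have "rot l (rot (opp l) x) = rot l (rot (opp l) y)" using same eq by (simp add: f_def)
      then show ?thesis by simp
    qed
  qed
  have disj: "f (True, True) ` ?X \<inter> f (False, True) ` ?X = {}"
  proof (rule ccontr)
    assume "f (True, True) ` ?X \<inter> f (False, True) ` ?X \<noteq> {}"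
    then obtain x y where xy: "x \<in> ?X" "y \<in> ?X" "f (True, True) x = f (False, True) y" by blast
    from c_f[OF xy(1), of "(True, True)"] c_f[OF xy(2), of "(False, True)"]
    show False unfolding xy(3)
      by (auto dest: begins_with_unique simp: opp_def split: if_splits)
  qed
  show ?thesis
    unfolding paradoxical_def 
    by (intro exI[of _ "f (True, True)"] exI[of _ "f (False, True)"] conjI pw inj img disj)
qed

section \<open>Absorbing bounded sets\<close>

text \<open>
  With a new index, one half of the paradox makes room for the new copy and the other half
  pushes all earlier copies out of its way.
\<close>

lemma paradoxical_copies:
  assumes "paradoxical X" "finite C"
  shows "\<exists>f. (\<forall>c\<in>C. piecewise_isometry (f c) X \<and> f c ` X \<subseteq> X) \<and>
    (\<forall>c\<in>C. \<forall>d\<in>C. \<forall>x\<in>X. \<forall>y\<in>X. f c x = f d y \<longrightarrow> c = d \<and> x = y)"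
  using assms(2)
proof (induction C)
  case empty
  show ?case by blast
next
  case (insert a C)
  obtain p q where pq: "piecewise_isometry p X" "piecewise_isometry q X" "inj_on p X" "inj_on q X"
      "p ` X \<subseteq> X" "q ` X \<subseteq> X" "p ` X \<inter> q ` X = {}"
    using assms(1) unfolding paradoxical_def by blast
  from insert.IH obtain f where
      f': "\<forall>c\<in>C. piecewise_isometry (f c) X \<and> f c ` X \<subseteq> X"
      "\<forall>c\<in>C. \<forall>d\<in>C. \<forall>x\<in>X. \<forall>y\<in>X. f c x = f d y \<longrightarrow> c = d \<and> x = y"
    by (elim exE conjE) (rule that)
  have f: "\<And>c. c \<in> C \<Longrightarrow> piecewise_isometry (f c) X \<and> f c ` X \<subseteq> X"
      "\<And>c d x y. c \<in> C \<Longrightarrow> d \<in> C \<Longrightarrow> x \<in> X \<Longrightarrow> y \<in> X \<Longrightarrow> f c x = f d y \<Longrightarrow> c = d \<and> x = y"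
    using f' by simp_all
  define h where "h c = (if c = a then p else (\<lambda>x. q (f c x)))" for c
  have maps: "piecewise_isometry (h c) X \<and> h c ` X \<subseteq> X" if c: "c \<in> insert a C" for c
  proof (cases "c = a")
    case True
    then show ?thesis using pq by (simp add: h_def)
  next
    case False
    then have fc: "piecewise_isometry (f c) X" "f c ` X \<subseteq> X" using c f(1) by auto
    have "piecewise_isometry (\<lambda>x. q (f c x)) X"
      by (rule piecewise_isometry_comp[OF fc(1) pq(2) fc(2)])
    moreover have "(\<lambda>x. q (f c x)) ` X \<subseteq> X" using fc(2) pq(6) by blast
    ultimately show ?thesis using False by (simp add: h_def)
  qed
  have disj: "c = d \<and> x = y"
    if cd: "c \<in> insert a C" "d \<in> insert a C" and xy: "x \<in> X" "y \<in> X"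
      and eq: "h c x = h d y" for c d x y
  proof -
    have fX: "f e z \<in> X" if "e \<in> C" "z \<in> X" for e z using f(1) that by blast
    have disj: "p u \<noteq> q w" if "u \<in> X" "w \<in> X" for u w using pq(7) that by blast
    consider "c = a" "d = a" | "c = a" "d \<noteq> a" "d \<in> C" | "c \<noteq> a" "c \<in> C" "d = a"
      | "c \<noteq> a" "c \<in> C" "d \<noteq> a" "d \<in> C" using cd by blast
    then show ?thesis
    proof cases
      case 1
      then show ?thesis using eq xy pq(3) by (simp add: h_def inj_on_eq_iff)
    next
      case 2
      then show ?thesis using eq disj[OF xy(1) fX[OF 2(3) xy(2)]] by (simp add: h_def)
    next
      case 3
      then show ?thesis using eq disj[OF xy(2) fX[OF 3(2) xy(1)]] by (simp add: h_def)
    next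
      case 4
      then have "q (f c x) = q (f d y)" using eq by (simp add: h_def)
      then have "f c x = f d y" using pq(4) fX 4 xy by (meson inj_onD)
      then show ?thesis using f(2) 4 xy by blast
    qed
  qed
  have "\<forall>c\<in>insert a C. piecewise_isometry (h c) X \<and> h c ` X \<subseteq> X"
    by (intro ballI maps)
  moreover have "\<forall>c\<in>insert a C. \<forall>d\<in>insert a C. \<forall>x\<in>X. \<forall>y\<in>X. h c x = h d y \<longrightarrow> c = d \<and> x = y"
    by (intro ballI impI) (rule disj)
  ultimately show ?case
    by (intro exI[of _ h]) (rule conjI)
qed

lemma translation_in_isometry_group:
  fixes a :: "'a::real_normed_vector"
  shows "(\<lambda>x. x + a) \<in> isometry_group"
  by (simp add: isometry_group_def bij_plus_right)

lemma finitely_many_translates_cover: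
  fixes Q :: "(real^3) set"
  assumes Q: "bounded Q" and r: "r > 0"
  shows "\<exists>C. finite C \<and> (\<forall>x\<in>Q. \<exists>c\<in>C. x - c \<in> ball 0 r - axes)"
proof -
  \<comment> \<open>A short shift \<open>v\<close> that moves no point of the axes to a point of the axes.\<close>
  have "\<not> negligible (ball (0::real^3) (r/2))"
    using r by (intro open_not_negligible) auto
  then have "\<not> ball 0 (r/2) \<subseteq> {p - q |p q. p \<in> axes \<and> q \<in> axes}"
    using axes_differences_negligible negligible_subset by blast
  then obtain v where v: "v \<in> ball 0 (r/2)" "\<And>p q. p \<in> axes \<Longrightarrow> q \<in> axes \<Longrightarrow> v \<noteq> p - q"
    by blast
  have comp: "compact (closure Q)" using Q by simp
  have cover: "closure Q \<subseteq> (\<Union>y\<in>UNIV. ball y (r/2))"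
  proof
    fix x
    have "x \<in> ball x (r/2)" using r by simp
    then show "x \<in> (\<Union>y\<in>UNIV. ball y (r/2))" by blast
  qed
  obtain D where D: "finite D" "closure Q \<subseteq> (\<Union>y\<in>D. ball y (r/2))"
    by (rule compactE_image[OF comp _ cover], simp, blast)
  \<comment> \<open>Radius \<open>r/2\<close> leaves room for the shift: if \<open>x\<close> is within \<open>r/2\<close> of \<open>y\<close>, then \<open>x - y\<close> and \<open>x - (y + v)\<close> both have norm below \<open>r\<close>.\<close>
  have "\<exists>c\<in>D \<union> (\<lambda>y. y + v) ` D. x - c \<in> ball 0 r - axes" if x: "x \<in> Q" for x
  proof -
    obtain y where y: "y \<in> D" "x \<in> ball y (r/2)"
      using x D(2) closure_subset[of Q] by blast
    have n: "norm (x - y) < r/2" using y(2) by (simp add: dist_norm norm_minus_commute)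
    have n': "norm (x - (y + v)) < r"
      using norm_triangle_ineq4[of "x - y" v] n v(1) by (simp add: diff_diff_eq)
    show ?thesis
    proof (cases "x - y \<in> axes")
      case False
      then show ?thesis using n r y(1) by (intro bexI[of _ y]) auto
    next
      case True
      then have "x - (y + v) \<notin> axes" using v(2)[of "x - y" "x - (y + v)"] by auto
      then show ?thesis using n' y(1) by (intro bexI[of _ "y + v"]) auto
    qed
  qed
  then show ?thesis using D(1) by (intro exI[of _ "D \<union> (\<lambda>y. y + v) ` D"]) auto
qed

theorem bounded_piecewise_embeds:
  fixes Q T :: "(real^3) set"
  assumes Q: "bounded Q" and T: "interior T \<noteq> {}"
  shows "piecewise_embeds Q T"
proof -
  obtain t r where r: "r > 0" "ball t r \<subseteq> T"
    using T by (meson ex_in_conv mem_interior)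
  let ?X = "ball 0 r - axes"
  obtain C where C: "finite C" "\<And>x. x \<in> Q \<Longrightarrow> \<exists>c\<in>C. x - c \<in> ?X"
    using finitely_many_translates_cover[OF Q r(1)] by blast
  from paradoxical_copies[OF paradoxical_ball_off_axes[of r] C(1)] obtain f where
      f': "\<forall>c\<in>C. piecewise_isometry (f c) ?X \<and> f c ` ?X \<subseteq> ?X"
      "\<forall>c\<in>C. \<forall>d\<in>C. \<forall>x\<in>?X. \<forall>y\<in>?X. f c x = f d y \<longrightarrow> c = d \<and> x = y"
    by (elim exE conjE) (rule that)
  have f: "\<And>c. c \<in> C \<Longrightarrow> piecewise_isometry (f c) ?X \<and> f c ` ?X \<subseteq> ?X"
      "\<And>c d x y. c \<in> C \<Longrightarrow> d \<in> C \<Longrightarrow> x \<in> ?X \<Longrightarrow> y \<in> ?X \<Longrightarrow> f c x = f d y \<Longrightarrow> c = d \<and> x = y"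
    using f' by blast+
  obtain k where k: "\<And>x. x \<in> Q \<Longrightarrow> k x \<in> C" "\<And>x. x \<in> Q \<Longrightarrow> x - k x \<in> ?X"
    using C(2) by metis
  define h where "h x = f (k x) (x - k x) + t" for x
  have "piecewise_isometry h Q"
    unfolding h_def
  proof (rule piecewise_isometry_glue[of C _ k "\<lambda>c x. f c (x - c) + t"])
    show "finite C" by fact
    show "k x \<in> C" if "x \<in> Q" for x using k that by blast
    fix c assume c: "c \<in> C"
    have "piecewise_isometry (\<lambda>x. x - c) {x \<in> Q. k x = c}"
      using piecewise_isometry_isometry[OF translation_in_isometry_group[of "- c"]] by simp
    moreover have "(\<lambda>x. x - c) ` {x \<in> Q. k x = c} \<subseteq> ?X" using k(2) by blast
    ultimately have "piecewise_isometry (\<lambda>x. f c (x - c)) {x \<in> Q. k x = c}"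
      using f(1)[OF c] by (intro piecewise_isometry_comp[of "\<lambda>x. x - c" _ "f c" ?X]) auto
    then show "piecewise_isometry (\<lambda>x. f c (x - c) + t) {x \<in> Q. k x = c}"
      by (rule piecewise_isometry_comp[OF _
            piecewise_isometry_isometry[OF translation_in_isometry_group[of t]] subset_UNIV])
  qed
  moreover have "inj_on h Q"
  proof (rule inj_onI)
    fix x y assume xy: "x \<in> Q" "y \<in> Q" "h x = h y"
    then have "f (k x) (x - k x) = f (k y) (y - k y)" by (simp add: h_def)
    then have "k x = k y \<and> x - k x = y - k y" using f(2) k xy by blast
    then show "x = y" by (metis diff_add_cancel)
  qed
  moreover have "h ` Q \<subseteq> T"
  proof
    fix y assume "y \<in> h ` Q"
    then obtain x where x: "x \<in> Q" "y = h x" by blast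
    then have "f (k x) (x - k x) \<in> ?X" using f(1) k by blast
    then have "y \<in> ball t r" unfolding x(2) h_def by (simp add: dist_norm)
    then show "y \<in> T" using r(2) by blast
  qed
  ultimately show ?thesis unfolding piecewise_embeds_def by blast
qed

theorem mainTheorem1:
  fixes Q T :: "(real^3) set"
  assumes "bounded Q" and "interior Q \<noteq> {}"
    and "bounded T" and "interior T \<noteq> {}"
  shows "equidecomposable G3 Q T"
  using assms by (intro equidecomposable_if_piecewise_embeds bounded_piecewise_embeds)

end
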